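(* Let $N_3(n)$ denote the number of pairwise non-isomorphic strong tricentral $2$-trees on $n$ vertices whose tail vertices all have degree in $\{2,3\}$ (over all possible maximum degrees). There exists an absolute constant $c>0$ such that $N_3(n)\ge c\,n^2$ for all sufficiently large $n$ with $n\equiv 0\pmod 3$. In particular, $N_3(n)\ge \left\lfloor \frac{(n-15)^2}{72}\right\rfloor$ for every $n\ge 24$ with $n\equiv 0\pmod 3$.
   Context: A $2$-tree is a graph obtained from the triangle $K_3$ by repeatedly adding a new vertex adjacent to both endpoints of an existing edge. For $r\in\{1,2,3\}$ and an integer $\Delta\ge 2$, a $2$-tree on $n$ vertices is $r$-central with maximum degree $\Delta$ if $\Delta$ is its maximum degree and exactly $r$ vertices have degree $\Delta$; these $r$ vertices form the core and the other $n-r$ vertices form the tail. It is strong if the core induces $K_r$. "Tricentral" means $3$-central. *)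

theory Defs
  imports Complex_Main "HOL-Library.Ramsey"
begin

text \<open>
  A simple graph is given by its vertex set and its set of edges, an edge being a two-element
  set of vertices. The notation \<open>[V]\<^bsup>2\<^esup>\<close> (theory Ramsey) is the set of all two-element subsets
  of \<open>V\<close>, i.e. the edge set of the complete graph on \<open>V\<close>.
\<close>

type_synonym 'a graph = "'a set \<times> 'a set set"

definition degree :: "'a graph \<Rightarrow> 'a \<Rightarrow> nat" where
  "degree G v = card {e \<in> snd G. v \<in> e}"

definition max_degree :: "'a graph \<Rightarrow> nat" where
  "max_degree G = Max (degree G ` fst G)"

definition induced :: "'a graph \<Rightarrow> 'a set \<Rightarrow> 'a graph" where
  "induced G C = (C, {e \<in> snd G. e \<subseteq> C})"

definition complete_graph :: "'a set \<Rightarrow> 'a graph" where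
  "complete_graph C = (C, [C]\<^bsup>2\<^esup>)"

definition graph_iso :: "'a graph \<Rightarrow> 'b graph \<Rightarrow> bool" where
  "graph_iso G H \<longleftrightarrow>
     (\<exists>f. bij_betw f (fst G) (fst H) \<and>
          (\<forall>u\<in>fst G. \<forall>v\<in>fst G. {u, v} \<in> snd G \<longleftrightarrow> {f u, f v} \<in> snd H))"

inductive two_tree :: "'a graph \<Rightarrow> bool" where
  triangle: "card T = 3 \<Longrightarrow> two_tree (complete_graph T)"
| add_vertex: "two_tree (V, E) \<Longrightarrow> {u, v} \<in> E \<Longrightarrow> w \<notin> V \<Longrightarrow>
    two_tree (insert w V, E \<union> {{w, u}, {w, v}})"

definition core :: "'a graph \<Rightarrow> nat \<Rightarrow> 'a set" where
  "core G \<Delta> = {v \<in> fst G. degree G v = \<Delta>}"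

definition tail :: "'a graph \<Rightarrow> nat \<Rightarrow> 'a set" where
  "tail G \<Delta> = fst G - core G \<Delta>"

definition central_two_tree :: "nat \<Rightarrow> nat \<Rightarrow> 'a graph \<Rightarrow> bool" where
  "central_two_tree r \<Delta> G \<longleftrightarrow>
     r \<in> {1, 2, 3} \<and> \<Delta> \<ge> 2 \<and> two_tree G \<and> max_degree G = \<Delta> \<and> card (core G \<Delta>) = r"

definition strong_central_two_tree :: "nat \<Rightarrow> nat \<Rightarrow> 'a graph \<Rightarrow> bool" where
  "strong_central_two_tree r \<Delta> G \<longleftrightarrow>
     central_two_tree r \<Delta> G \<and> induced G (core G \<Delta>) = complete_graph (core G \<Delta>)"

text \<open>
  Isomorphism types of graphs on \<open>n\<close> vertices are counted as isomorphism classes of labelled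
  graphs with vertex set \<open>{0..<n}\<close>.
\<close>

definition tricentral_family :: "nat \<Rightarrow> nat graph set" where
  "tricentral_family n =
     {G. fst G = {0..<n} \<and>
         (\<exists>\<Delta>. strong_central_two_tree 3 \<Delta> G \<and> (\<forall>v\<in>tail G \<Delta>. degree G v \<in> {2, 3}))}"

definition iso_rel_on :: "'a graph set \<Rightarrow> 'a graph rel" where
  "iso_rel_on S = {(G, H) \<in> S \<times> S. graph_iso G H}"

definition N3 :: "nat \<Rightarrow> nat" where
  "N3 n = card (tricentral_family n // iso_rel_on (tricentral_family n))"

text \<open>
  The last two lemmas show that the cardinality defining \<open>N3\<close> is that of a finite quotient by an
  equivalence relation.
\<close>

lemma two_tree_simple: "two_tree G \<Longrightarrow> finite (fst G) \<and> snd G \<subseteq> [fst G]\<^bsup>2\<^esup>"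
proof (induction rule: two_tree.induct)
  case (triangle T)
  then have "finite T" by (intro card_ge_0_finite) simp
  then show ?case by (simp add: complete_graph_def)
next
  case (add_vertex V E u v w)
  have "{u, v} \<in> [V]\<^bsup>2\<^esup>" using add_vertex.hyps(2) add_vertex.IH unfolding snd_conv fst_conv by blast
  then have "u \<in> V" "v \<in> V" by (auto simp: nsets_def)
  with add_vertex show ?case by (auto simp: nsets_def card_insert_if)
qed

lemma equiv_iso_rel_on: "equiv S (iso_rel_on S)"
proof (rule equivI)
  show "refl_on S (iso_rel_on S)"
    by (auto simp: refl_on_def iso_rel_on_def graph_iso_def intro!: exI[of _ "\<lambda>x. x"] bij_betw_id[unfolded id_def])
  show "sym (iso_rel_on S)"
  proof (rule symI)
    fix G H assume "(G, H) \<in> iso_rel_on S"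
    then obtain f where S: "G \<in> S" "H \<in> S" and f: "bij_betw f (fst G) (fst H)"
      and adj: "\<forall>u\<in>fst G. \<forall>v\<in>fst G. {u, v} \<in> snd G \<longleftrightarrow> {f u, f v} \<in> snd H"
      by (auto simp: iso_rel_on_def graph_iso_def)
    let ?g = "inv_into (fst G) f"
    have g: "bij_betw ?g (fst H) (fst G)" by (rule bij_betw_inv_into[OF f])
    have fg: "?g x \<in> fst G \<and> f (?g x) = x" if "x \<in> fst H" for x
      using that f g by (metis bij_betw_apply bij_betw_inv_into_right)
    have "\<forall>u\<in>fst H. \<forall>v\<in>fst H. {u, v} \<in> snd H \<longleftrightarrow> {?g u, ?g v} \<in> snd G"
      using adj fg by simp
    with g S show "(H, G) \<in> iso_rel_on S"
      unfolding iso_rel_on_def graph_iso_def by blast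
  qed
  show "trans (iso_rel_on S)"
  proof (rule transI)
    fix G H K assume "(G, H) \<in> iso_rel_on S" "(H, K) \<in> iso_rel_on S"
    then obtain f g where S: "G \<in> S" "K \<in> S"
      and f: "bij_betw f (fst G) (fst H)" and g: "bij_betw g (fst H) (fst K)"
      and af: "\<forall>u\<in>fst G. \<forall>v\<in>fst G. {u, v} \<in> snd G \<longleftrightarrow> {f u, f v} \<in> snd H"
      and ag: "\<forall>u\<in>fst H. \<forall>v\<in>fst H. {u, v} \<in> snd H \<longleftrightarrow> {g u, g v} \<in> snd K"
      by (auto simp: iso_rel_on_def graph_iso_def)
    have "bij_betw (g \<circ> f) (fst G) (fst K)" by (rule bij_betw_trans[OF f g])
    moreover have "\<forall>u\<in>fst G. \<forall>v\<in>fst G. {u, v} \<in> snd G \<longleftrightarrow> {(g \<circ> f) u, (g \<circ> f) v} \<in> snd K"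
      using af ag bij_betwE[OF f] by simp
    ultimately show "(G, K) \<in> iso_rel_on S"
      using S unfolding iso_rel_on_def graph_iso_def by blast
  qed
qed (auto simp: iso_rel_on_def)

lemma finite_tricentral_family: "finite (tricentral_family n)"
proof (rule finite_subset)
  show "tricentral_family n \<subseteq> {{0..<n}} \<times> Pow (Pow {0..<n})"
  proof
    fix G assume "G \<in> tricentral_family n"
    then have V: "fst G = {0..<n}" and "two_tree G"
      by (auto simp: tricentral_family_def strong_central_two_tree_def central_two_tree_def)
    with two_tree_simple[of G] have "snd G \<subseteq> Pow {0..<n}" by (auto simp: nsets_def)
    with V show "G \<in> {{0..<n}} \<times> Pow (Pow {0..<n})" by (cases G) auto
  qed
qed simp

end

theory Submission
  imports Defs
begin

text \<open>
  A tail vertex of degree at most 3 sits in a fan: a path whose vertices are all joined to one core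
  vertex, its hub, and whose first vertex is also joined to a second core vertex. Equip the three
  directed core edges \<open>(i, i + 1 mod 3)\<close> with the same composition of \<open>m = n / 3 - 1\<close> into fan
  sizes; by symmetry the three core degrees agree. The composition is encoded by the set \<open>S\<close> of
  positions at which a new fan starts. Counting degree-2 vertices gives three times the number of
  fans, and counting those with a neighbour of degree 3 gives three times the number of fans of
  size at least 2, so these two numbers separate isomorphism types. With \<open>x\<close> fans of size 1,
  \<open>q - 1\<close> fans of size 2 and one long fan, every pair \<open>(x, q)\<close> with \<open>q \<ge> 1\<close> and \<open>x + 2 q \<le> m\<close>
  occurs; the box \<open>x \<le> m - 2 b\<close>, \<open>1 \<le> q \<le> b\<close> with \<open>b\<close> about \<open>m / 4\<close> already contains enough pairs.
\<close>

section \<open>Isomorphism invariants and the number of isomorphism classes\<close>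

lemma degree_eq_card_neighbours:
  assumes "snd G \<subseteq> [fst G]\<^bsup>2\<^esup>"
  shows "degree G v = card {u \<in> fst G. {u, v} \<in> snd G}"
proof -
  have "bij_betw (\<lambda>u. {u, v}) {u \<in> fst G. {u, v} \<in> snd G} {e \<in> snd G. v \<in> e}"
  proof (rule bij_betwI')
    fix e assume e: "e \<in> {e \<in> snd G. v \<in> e}"
    with assms have "e \<in> [fst G]\<^bsup>2\<^esup>" by blast
    then obtain a b where ab: "e = {a, b}" "a \<in> fst G" "b \<in> fst G"
      by (auto simp: nsets_def card_2_iff)
    with e have "e = {b, v} \<or> e = {a, v}" by blast
    then obtain u where "e = {u, v}" "u \<in> fst G" using ab by blast
    with e show "\<exists>u\<in>{u \<in> fst G. {u, v} \<in> snd G}. e = {u, v}"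
      by blast
  qed (auto simp: doubleton_eq_iff)
  then show ?thesis
    unfolding degree_def by (rule bij_betw_same_card[symmetric])
qed

definition type_invariant :: "'a graph \<Rightarrow> nat \<times> nat" where
  "type_invariant G =
     (card {v \<in> fst G. degree G v = 2},
      card {v \<in> fst G. degree G v = 2 \<and> (\<exists>u\<in>fst G. {u, v} \<in> snd G \<and> degree G u = 3)})"

lemma type_invariant_iso:
  assumes "graph_iso G H" "snd G \<subseteq> [fst G]\<^bsup>2\<^esup>" "snd H \<subseteq> [fst H]\<^bsup>2\<^esup>"
  shows "type_invariant G = type_invariant H"
proof -
  obtain f where f: "bij_betw f (fst G) (fst H)"
    and adj: "\<And>u v. u \<in> fst G \<Longrightarrow> v \<in> fst G \<Longrightarrow> {u, v} \<in> snd G \<longleftrightarrow> {f u, f v} \<in> snd H"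
    using assms(1) by (auto simp: graph_iso_def)
  have img: "f ` fst G = fst H" and inj: "inj_on f (fst G)"
    using f by (auto simp: bij_betw_def)
  have transport: "card {v \<in> fst H. Q v} = card {v \<in> fst G. P v}"
    if "\<And>v. v \<in> fst G \<Longrightarrow> P v \<longleftrightarrow> Q (f v)" for P Q
  proof -
    have "{v \<in> fst H. Q v} = f ` {v \<in> fst G. P v}"
      using that by (auto simp: img[symmetric])
    then show ?thesis
      by (simp add: card_image inj_on_subset[OF inj])
  qed
  have deg: "degree H (f v) = degree G v" if "v \<in> fst G" for v
    unfolding degree_eq_card_neighbours[OF assms(2)] degree_eq_card_neighbours[OF assms(3)]
    by (rule transport) (simp add: adj that)
  have "(\<exists>u\<in>fst H. {u, f v} \<in> snd H \<and> degree H u = 3) \<longleftrightarrow>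
      (\<exists>u\<in>fst G. {u, v} \<in> snd G \<and> degree G u = 3)" if "v \<in> fst G" for v
    unfolding img[symmetric] using that adj deg by auto
  then show ?thesis
    unfolding type_invariant_def
    by (auto intro!: transport[symmetric] simp: deg)
qed

lemma card_image_le_card_quotient:
  assumes "finite S" "\<And>G H. G \<in> S \<Longrightarrow> H \<in> S \<Longrightarrow> graph_iso G H \<Longrightarrow> f G = f H"
  shows "card (f ` S) \<le> card (S // iso_rel_on S)"
proof (rule surj_card_le)
  show "finite (S // iso_rel_on S)"
    unfolding quotient_def using assms(1) by simp
  show "f ` S \<subseteq> (\<lambda>X. the_elem (f ` X)) ` (S // iso_rel_on S)"
  proof (rule image_subsetI)
    fix G assume G: "G \<in> S"
    have "G \<in> iso_rel_on S `` {G}"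
      by (rule equiv_class_self[OF equiv_iso_rel_on G])
    then have "f ` (iso_rel_on S `` {G}) = {f G}"
      using assms(2)[of G] by (auto simp: iso_rel_on_def)
    then show "f G \<in> (\<lambda>X. the_elem (f ` X)) ` (S // iso_rel_on S)"
      by (intro image_eqI[of _ _ "iso_rel_on S `` {G}"]) (auto intro: quotientI G)
  qed
qed

lemma card_type_invariants_le_N3: "card (type_invariant ` tricentral_family n) \<le> N3 n"
  unfolding N3_def
proof (rule card_image_le_card_quotient[OF finite_tricentral_family])
  fix G H assume "G \<in> tricentral_family n" "H \<in> tricentral_family n" "graph_iso G H"
  then show "type_invariant G = type_invariant H"
    by (intro type_invariant_iso)
      (auto simp: tricentral_family_def strong_central_two_tree_def central_two_tree_def
        dest!: two_tree_simple)
qed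

section \<open>Fan graphs as 2-trees\<close>

text \<open>
  Vertex \<open>w \<ge> 3\<close> is position \<open>w div 3\<close> of the fans with hub \<open>w mod 3\<close>; its predecessor there is
  \<open>w - 3\<close>.
\<close>

definition fan_parent :: "nat set \<Rightarrow> nat \<Rightarrow> nat" where
  "fan_parent S w = (if w div 3 \<in> S then (w + 1) mod 3 else w - 3)"

text \<open>Both parents of \<open>w\<close> are smaller than \<open>w\<close>. The bound
  \<open>k\<close> is arbitrary so that the graph can grow by one vertex at a time.\<close>

definition fan_graph :: "nat set \<Rightarrow> nat \<Rightarrow> nat graph" where
  "fan_graph S k =
     ({0..<k}, [{0..<3}]\<^bsup>2\<^esup> \<union> (\<Union>w\<in>{3..<k}. {{w, w mod 3}, {w, fan_parent S w}}))"

lemma fst_fan_graph [simp]: "fst (fan_graph S k) = {0..<k}"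
  by (simp add: fan_graph_def)

lemma fan_graph_edge_iff:
  "{u, v} \<in> snd (fan_graph S k) \<longleftrightarrow>
     u < 3 \<and> v < 3 \<and> u \<noteq> v \<or>
     3 \<le> u \<and> u < k \<and> (v = u mod 3 \<or> v = fan_parent S u) \<or>
     3 \<le> v \<and> v < k \<and> (u = v mod 3 \<or> u = fan_parent S v)"
proof -
  have "{u, v} \<in> [{0..<3}]\<^bsup>2\<^esup> \<longleftrightarrow> u < 3 \<and> v < 3 \<and> u \<noteq> v"
    by (auto simp: nsets_def card_insert_if)
  then show ?thesis
    unfolding fan_graph_def by (auto simp: doubleton_eq_iff)
qed

text \<open>This is the adjacency needed to attach \<open>k\<close>. At a fan start both parents are
  distinct core vertices; otherwise \<open>k - 3\<close> has the same hub. Position 1 must start a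
  fan because there \<open>k - 3\<close> would be the hub itself.\<close>

lemma fan_graph_edge_parents:
  assumes "1 \<in> S" "3 \<le> k"
  shows "{k mod 3, fan_parent S k} \<in> snd (fan_graph S k)"
proof (cases "k div 3 \<in> S")
  case True
  then have "fan_parent S k < 3" "k mod 3 \<noteq> fan_parent S k" "k mod 3 < 3"
    by (auto simp: fan_parent_def mod_Suc)
  then show ?thesis
    by (simp add: fan_graph_edge_iff)
next
  case False
  with assms have "k div 3 \<noteq> 1" by metis
  with assms have "6 \<le> k" by linarith
  moreover from this have "(k - 3) mod 3 = k mod 3"
    by (simp add: le_mod_geq)
  ultimately show ?thesis
    using False by (auto simp: fan_graph_edge_iff fan_parent_def)
qed

lemma two_tree_fan_graph:
  assumes "1 \<in> S" "3 \<le> k"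
  shows "two_tree (fan_graph S k)"
  using assms(2)
proof (induction k rule: dec_induct)
  case base
  have "two_tree (complete_graph {0..<3::nat})"
    by (rule two_tree.triangle) simp
  then show ?case
    by (simp add: fan_graph_def complete_graph_def)
next
  case (step k)
  have "two_tree (insert k {0..<k},
      snd (fan_graph S k) \<union> {{k, k mod 3}, {k, fan_parent S k}})"
    by (rule two_tree.add_vertex)
      (use step fan_graph_edge_parents[OF assms(1)] in \<open>auto simp: fan_graph_def\<close>)
  moreover have "{3..<Suc k} = insert k {3..<k}" "{0..<Suc k} = insert k {0..<k}"
    using step.hyps by auto
  ultimately show ?case
    by (simp add: fan_graph_def Un_ac insert_commute)
qed

section \<open>Degrees in a fan graph and membership in the family\<close>

locale fan_triangle =
  fixes S :: "nat set" and m :: nat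
  assumes S_subset: "S \<subseteq> {1..m}" and one_in_S: "1 \<in> S"
begin

abbreviation "G \<equiv> fan_graph S (3 * m + 3)"

lemma finite_S: "finite S"
  using S_subset finite_subset by blast

lemma m_pos: "1 \<le> m"
  using S_subset one_in_S by auto

lemma card_S_pos: "1 \<le> card S"
  using one_in_S finite_S by (metis One_nat_def Suc_leI card_gt_0_iff empty_iff)

lemma two_tree_G: "two_tree G"
  by (rule two_tree_fan_graph[OF one_in_S]) simp

lemma degree_G: "degree G v = card {u \<in> {0..<3 * m + 3}. {u, v} \<in> snd G}"
  using degree_eq_card_neighbours[of G v] two_tree_simple[OF two_tree_G] by simp

text \<open>The summands count the two other core vertices (\<open>?A\<close>), the \<open>m\<close>
  vertices with hub \<open>v\<close> (\<open>?B\<close>), and the fan starts of the preceding hub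
  \<open>v + 2\<close> mod 3 (\<open>?C\<close>). Residues mod 3 separate \<open>?B\<close> from
  \<open>?C\<close>.\<close>

lemma degree_core:
  assumes "v < 3"
  shows "degree G v = 2 + m + card S"
proof -
  let ?A = "{0..<3} - {v}" and ?B = "(\<lambda>j. 3 * j + v) ` {1..m}"
    and ?C = "(\<lambda>j. 3 * j + (v + 2) mod 3) ` S"
  have "{u \<in> {0..<3 * m + 3}. {u, v} \<in> snd G} = ?A \<union> ?B \<union> ?C"
  proof (intro set_eqI iffI)
    fix u assume "u \<in> {u \<in> {0..<3 * m + 3}. {u, v} \<in> snd G}"
    then have u: "u < 3 * m + 3" "{u, v} \<in> snd G" by auto
    show "u \<in> ?A \<union> ?B \<union> ?C"
    proof (cases "u < 3")
      case True
      then show ?thesis using u assms by (auto simp: fan_graph_edge_iff)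
    next
      case False
      then have div: "u div 3 \<in> {1..m}" using u by auto
      have eq: "u = 3 * (u div 3) + u mod 3" by simp
      consider "v = u mod 3" | "v = fan_parent S u" "v \<noteq> u mod 3"
        using u False assms by (auto simp: fan_graph_edge_iff)
      then show ?thesis
      proof cases
        case 1
        then have "u = 3 * (u div 3) + v" by simp
        then show ?thesis using div by blast
      next
        case 2
        \<comment> \<open>If \<open>u\<close> did not start a fan, its parent
          \<open>v = u - 3\<close> would be its own hub, which this case excludes.\<close>
        have "u div 3 \<in> S"
        proof (rule ccontr)
          assume "u div 3 \<notin> S"
          then have "v = u - 3" using 2 by (simp add: fan_parent_def)
          then have "u = v + 3" using False by simp
          then have "u mod 3 = v" using assms by simp
          then show False using 2 by simp
        qed
        moreover from this have "v = (u + 1) mod 3"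
          using 2 by (simp add: fan_parent_def)
        then have "u mod 3 = (v + 2) mod 3"
          by (simp add: mod_Suc) linarith
        ultimately have "u \<in> ?C" using eq by (metis image_eqI)
        then show ?thesis by blast
      qed
    qed
  next
    fix u assume "u \<in> ?A \<union> ?B \<union> ?C"
    then consider "u \<in> ?A" | j where "j \<in> {1..m}" "u = 3 * j + v"
      | j where "j \<in> S" "u = 3 * j + (v + 2) mod 3" by blast
    then show "u \<in> {u \<in> {0..<3 * m + 3}. {u, v} \<in> snd G}"
    proof cases
      case 3
      define r where "r = (v + 2) mod 3"
      have r: "r < 3" "(r + 1) mod 3 = v"
        using assms by (auto simp: r_def mod_simps)
      have u: "u = 3 * j + r" using 3 by (simp add: r_def)
      have j: "1 \<le> j" "j \<le> m" using 3 S_subset by auto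
      have "u div 3 = j" using u r by simp
      moreover have "(u + 1) mod 3 = v" using u r(2) by (simp add: mod_mult_self4)
      ultimately have "fan_parent S u = v" using 3 by (simp add: fan_parent_def)
      then show ?thesis using u r j by (simp add: fan_graph_edge_iff)
    qed (use assms in \<open>auto simp: fan_graph_edge_iff\<close>)
  qed
  moreover have "card ?A = 2" using assms by simp
  moreover have "card ?B = m" by (subst card_image) (auto simp: inj_on_def)
  moreover have "card ?C = card S" by (subst card_image) (auto simp: inj_on_def)
  moreover have "?A \<inter> ?B = {}" by auto
  moreover have "(?A \<union> ?B) \<inter> ?C = {}"
  proof -
    have ne: "3 * i + v \<noteq> 3 * j + (v + 2) mod 3" for i j
    proof -
      have "v = 0 \<or> v = 1 \<or> v = 2" using assms by linarith
      then show ?thesis by (elim disjE; simp; presburger)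
    qed
    show ?thesis
    proof (rule equals0I)
      fix x assume x: "x \<in> (?A \<union> ?B) \<inter> ?C"
      then obtain j where j: "j \<in> S" "x = 3 * j + (v + 2) mod 3" by blast
      then have "1 \<le> j" using S_subset by auto
      then have "x \<in> ?B" using x j(2) by auto
      then obtain i where "x = 3 * i + v" by blast
      with j(2) ne[of i j] show False by argo
    qed
  qed
  ultimately show ?thesis
    by (simp add: degree_G card_Un_disjoint finite_S)
qed

text \<open>Besides its two parents, \<open>v\<close> can only be adjacent to its successor
  \<open>v + 3\<close>, which is missing when \<open>v\<close> is at the last position or the next
  position opens a new fan.\<close>

lemma degree_tail:
  assumes "3 \<le> v" "v < 3 * m + 3"
  shows "degree G v = (if v div 3 = m \<or> Suc (v div 3) \<in> S then 2 else 3)"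
proof -
  let ?next = "if v div 3 = m \<or> Suc (v div 3) \<in> S then {} else {v + 3}"
  have neq: "v mod 3 \<noteq> fan_parent S v"
  proof (cases "v div 3 \<in> S")
    case True
    then show ?thesis by (simp add: fan_parent_def mod_Suc)
  next
    case False
    then have "v div 3 \<noteq> 1" using one_in_S by metis
    then show ?thesis using False assms by (simp add: fan_parent_def)
  qed
  have lt: "fan_parent S v < v" "v mod 3 < v"
    using assms by (auto simp: fan_parent_def intro: less_le_trans[of _ 3])
  \<comment> \<open>Fan starts have only core parents, so a tail vertex is a parent only of the next
    vertex in its fan.\<close>
  have child: "v = fan_parent S u \<longleftrightarrow> u = v + 3 \<and> Suc (v div 3) \<notin> S" if "3 \<le> u" for u
  proof (cases "u div 3 \<in> S")
    case True
    have "fan_parent S u < 3" using True by (simp add: fan_parent_def)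
    moreover have "(v + 3) div 3 = Suc (v div 3)" by simp
    ultimately show ?thesis using assms True by auto
  next
    case False
    then have "fan_parent S u = u - 3" by (simp add: fan_parent_def)
    moreover have "(v + 3) div 3 = Suc (v div 3)" by simp
    ultimately show ?thesis using False that by (cases "u = v + 3") auto
  qed
  have last: "v + 3 < 3 * m + 3 \<longleftrightarrow> v div 3 \<noteq> m"
    using assms by presburger
  have "{u \<in> {0..<3 * m + 3}. {u, v} \<in> snd G} = {v mod 3, fan_parent S v} \<union> ?next"
  proof (intro set_eqI)
    fix u
    have "v \<noteq> u mod 3" using assms by presburger
    then have "{u, v} \<in> snd G \<longleftrightarrow> u = v mod 3 \<or> u = fan_parent S v \<or>
        3 \<le> u \<and> u < 3 * m + 3 \<and> v = fan_parent S u"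
      using assms unfolding fan_graph_edge_iff by auto
    then show "u \<in> {u \<in> {0..<3 * m + 3}. {u, v} \<in> snd G} \<longleftrightarrow>
        u \<in> {v mod 3, fan_parent S v} \<union> ?next"
      using assms lt child[of u] last by auto
  qed
  then show ?thesis
    using neq lt by (auto simp: degree_G card_insert_if)
qed

text \<open>Core degrees are at least 4, as \<open>m\<close> and \<open>card S\<close> are positive,
  whereas tail degrees are at most 3.\<close>

lemma degree_G_le: "v < 3 * m + 3 \<Longrightarrow> degree G v \<le> 2 + m + card S"
  and degree_G_eq_iff: "v < 3 * m + 3 \<Longrightarrow> degree G v = 2 + m + card S \<longleftrightarrow> v < 3"
proof -
  show "v < 3 * m + 3 \<Longrightarrow> degree G v \<le> 2 + m + card S"
    and "v < 3 * m + 3 \<Longrightarrow> degree G v = 2 + m + card S \<longleftrightarrow> v < 3"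
    using m_pos card_S_pos by (cases "v < 3"; simp add: degree_core degree_tail)+
qed

lemma core_G: "core G (2 + m + card S) = {0..<3}"
  using degree_G_eq_iff by (auto simp: core_def)

lemma max_degree_G: "max_degree G = 2 + m + card S"
  unfolding max_degree_def
proof (rule Max_eqI)
  show "2 + m + card S \<in> degree G ` fst G"
    using degree_core[of 0] by (intro image_eqI[of _ _ 0]) auto
qed (use degree_G_le in auto)

lemma G_in_tricentral_family: "G \<in> tricentral_family (3 * m + 3)"
proof -
  have "induced G {0..<3} = complete_graph {0..<3}"
    by (auto simp: induced_def complete_graph_def fan_graph_def nsets_def)
  then have "strong_central_two_tree 3 (2 + m + card S) G"
    unfolding strong_central_two_tree_def central_two_tree_def core_G
    by (simp add: two_tree_G max_degree_G)
  moreover have "degree G v \<in> {2, 3}" if "v \<in> tail G (2 + m + card S)" for v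
    using that unfolding tail_def core_G by (auto simp: degree_tail)
  ultimately show ?thesis
    unfolding tricentral_family_def by auto
qed

section \<open>The invariant of a fan graph\<close>

text \<open>Positions where a fan ends, the same for all three hubs. A position in both
  \<open>fan_ends\<close> and \<open>S\<close> is a fan of size 1, so \<open>fan_ends - S\<close>
  indexes the fans of size at least 2.\<close>

definition fan_ends :: "nat set" where
  "fan_ends = {j \<in> {1..m}. j = m \<or> Suc j \<in> S}"

lemma card_tail_blocks:
  assumes "J \<subseteq> {1..m}"
  shows "card {v \<in> {0..<3 * m + 3}. v div 3 \<in> J} = 3 * card J"
proof -
  have "bij_betw (\<lambda>v. (v div 3, v mod 3)) {v \<in> {0..<3 * m + 3}. v div 3 \<in> J} (J \<times> {0..<3})"
  proof (rule bij_betwI[where g = "\<lambda>(j, i). 3 * j + i"])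
    show "(\<lambda>(j, i). 3 * j + i) \<in> J \<times> {0..<3} \<rightarrow> {v \<in> {0..<3 * m + 3}. v div 3 \<in> J}"
      using assms by fastforce
  qed auto
  then show ?thesis
    by (auto dest!: bij_betw_same_card simp: card_cartesian_product)
qed

lemma degree_eq_2_iff:
  assumes "v < 3 * m + 3"
  shows "degree G v = 2 \<longleftrightarrow> v div 3 \<in> fan_ends"
proof (cases "v < 3")
  case True
  then show ?thesis using m_pos by (simp add: degree_core fan_ends_def)
next
  case False
  then have "1 \<le> v div 3" "v div 3 \<le> m" using assms by auto
  then show ?thesis using False assms by (auto simp: degree_tail fan_ends_def)
qed

text \<open>Core vertices have degree at least 4, so only the predecessor \<open>v - 3\<close>
  within the fan can have degree 3. It exists when \<open>v\<close> does not start its fan, and then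
  it has degree 3 because its fan continues.\<close>

lemma degree_3_neighbour_iff:
  assumes "v < 3 * m + 3" "v div 3 \<in> fan_ends"
  shows "(\<exists>u\<in>{0..<3 * m + 3}. {u, v} \<in> snd G \<and> degree G u = 3) \<longleftrightarrow> v div 3 \<notin> S"
proof
  assume "\<exists>u\<in>{0..<3 * m + 3}. {u, v} \<in> snd G \<and> degree G u = 3"
  then obtain u where u: "u < 3 * m + 3" "{u, v} \<in> snd G" "degree G u = 3" by auto
  have v: "3 \<le> v" using assms(2) by (auto simp: fan_ends_def)
  have u3: "3 \<le> u"
    using u(3) m_pos card_S_pos degree_core[of u] by linarith
  show "v div 3 \<notin> S"
  proof
    assume vS: "v div 3 \<in> S"
    have "u mod 3 < 3" "v mod 3 < 3" "fan_parent S v < 3"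
      using vS by (simp_all add: fan_parent_def)
    \<comment> \<open>Both parents of a fan start lie in the core, so the tail vertex
      \<open>u\<close> would have to be a child of \<open>v\<close>; but \<open>v\<close> ends its
      fan.\<close>
    then have eq: "v = fan_parent S u"
      using u u3 v unfolding fan_graph_edge_iff by linarith
    then have "u div 3 \<notin> S"
      using v by (auto simp: fan_parent_def)
    with eq have "u = v + 3" using u3 by (simp add: fan_parent_def)
    with \<open>u div 3 \<notin> S\<close> u assms(2) show False by (auto simp: fan_ends_def)
  qed
next
  assume vS: "v div 3 \<notin> S"
  then have "v div 3 \<noteq> 1" using one_in_S by metis
  moreover have "1 \<le> v div 3" using assms(2) by (simp add: fan_ends_def)
  ultimately have v6: "6 \<le> v" by linarith
  then have "Suc ((v - 3) div 3) = v div 3" "(v - 3) div 3 < m"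
    using assms(1) by (auto simp: le_div_geq)
  then have "degree G (v - 3) = 3"
    using degree_tail[of "v - 3"] v6 assms(1) vS by auto
  moreover have "{v - 3, v} \<in> snd G"
    using v6 assms(1) vS by (simp add: fan_graph_edge_iff fan_parent_def)
  ultimately show "\<exists>u\<in>{0..<3 * m + 3}. {u, v} \<in> snd G \<and> degree G u = 3"
    using assms(1) by (intro bexI[of _ "v - 3"]) auto
qed

text \<open>Every fan start except position 1 comes right after the end of the previous fan, and the
  one remaining end is \<open>m\<close>.\<close>

lemma card_fan_ends: "card fan_ends = card S"
proof -
  have "fan_ends = insert m ((\<lambda>j. j - 1) ` (S - {1}))"
    using S_subset m_pos by (force simp: fan_ends_def image_iff)
  moreover have "m \<notin> (\<lambda>j. j - 1) ` (S - {1})" using S_subset by force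
  moreover have "card ((\<lambda>j. j - 1) ` (S - {1})) = card (S - {1})"
    using S_subset by (intro card_image) (force simp: inj_on_def)
  ultimately show ?thesis
    using finite_S one_in_S card_Suc_Diff1[of S 1] by simp
qed

lemma type_invariant_G: "type_invariant G = (3 * card S, 3 * card (fan_ends - S))"
proof -
  have "fan_ends \<subseteq> {1..m}" by (auto simp: fan_ends_def)
  then have "card {v \<in> {0..<3 * m + 3}. v div 3 \<in> fan_ends} = 3 * card fan_ends"
    "card {v \<in> {0..<3 * m + 3}. v div 3 \<in> fan_ends - S} = 3 * card (fan_ends - S)"
    by (intro card_tail_blocks; blast)+
  moreover have "{v \<in> {0..<3 * m + 3}. degree G v = 2} =
      {v \<in> {0..<3 * m + 3}. v div 3 \<in> fan_ends}"
    using degree_eq_2_iff by auto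
  moreover have "{v \<in> {0..<3 * m + 3}. degree G v = 2 \<and>
        (\<exists>u\<in>{0..<3 * m + 3}. {u, v} \<in> snd G \<and> degree G u = 3)} =
      {v \<in> {0..<3 * m + 3}. v div 3 \<in> fan_ends - S}"
    using degree_eq_2_iff degree_3_neighbour_iff by auto
  ultimately show ?thesis
    unfolding type_invariant_def fst_fan_graph card_fan_ends by simp
qed

end

section \<open>Realising many invariants and the quadratic bound\<close>

lemma invariant_pair_realised:
  assumes "1 \<le> q" "x + 2 * q \<le> m"
  shows "(3 * (x + q), 3 * q) \<in> type_invariant ` tricentral_family (3 * m + 3)"
proof -
  \<comment> \<open>Positions 1 to \<open>x\<close> are fans of size 1. Fans then start at
    \<open>x + 1\<close>, \<open>x + 3\<close>, ..., \<open>x + 2 * q - 1\<close>; the last one runs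
    to \<open>m\<close> and has size at least 2 since \<open>x + 2 * q \<le> m\<close>.\<close>
  define S where "S = {1..x} \<union> (\<lambda>i. x + 2 * i + 1) ` {0..<q}"
  interpret fan_triangle S m
  proof
    show "S \<subseteq> {1..m}" using assms by (auto simp: S_def)
    show "1 \<in> S" using assms by (cases "x = 0") (auto simp: S_def intro: image_eqI[of _ _ 0])
  qed
  have "card S = x + q"
    unfolding S_def
    by (subst card_Un_disjoint) (auto simp: card_image inj_on_def)
  \<comment> \<open>The fans of size 2 end at \<open>x + 2 * i\<close> for
    \<open>1 \<le> i < q\<close>, the long fan at \<open>m\<close>.\<close>
  moreover have "fan_ends - S = insert m ((\<lambda>i. x + 2 * i) ` {1..<q})"
  proof (intro set_eqI iffI)
    fix j assume j: "j \<in> fan_ends - S"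
    show "j \<in> insert m ((\<lambda>i. x + 2 * i) ` {1..<q})"
    proof (cases "j = m")
      case False
      with j have "1 \<le> j" "Suc j \<in> S" "j \<notin> S" by (auto simp: fan_ends_def)
      then show ?thesis
        by (auto simp: S_def image_iff)
    qed simp
  next
    fix j assume "j \<in> insert m ((\<lambda>i. x + 2 * i) ` {1..<q})"
    then consider "j = m" | i where "1 \<le> i" "i < q" "j = x + 2 * i" by auto
    then show "j \<in> fan_ends - S"
    proof cases
      case 1
      have "m \<in> fan_ends" using m_pos by (simp add: fan_ends_def)
      moreover have "m \<notin> S" using assms by (auto simp: S_def)
      ultimately show ?thesis using 1 by simp
    next
      case 2
      then have "Suc j \<in> S" by (auto simp: S_def)
      moreover have "j \<notin> S" using 2 by (auto simp: S_def) presburger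
      ultimately show ?thesis using 2 assms by (auto simp: fan_ends_def)
    qed
  qed
  moreover have "card (insert m ((\<lambda>i. x + 2 * i) ` {1..<q})) = q"
  proof -
    have "m \<notin> (\<lambda>i. x + 2 * i) ` {1..<q}" using assms by auto
    then show ?thesis using assms by (simp add: card_image inj_on_def)
  qed
  ultimately have "type_invariant G = (3 * (x + q), 3 * q)"
    by (simp add: type_invariant_G)
  then show ?thesis using G_in_tricentral_family by (metis image_eqI)
qed

text \<open>The pair \<open>(x, q)\<close> can be recovered from its invariant, so distinct pairs in
  the box give distinct isomorphism types.\<close>

lemma N3_ge_box:
  assumes "2 * b \<le> m"
  shows "(m - 2 * b + 1) * b \<le> N3 (3 * m + 3)"
proof -
  let ?f = "\<lambda>(x, q). (3 * (x + q), 3 * q)"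
  let ?B = "{0..m - 2 * b} \<times> {1..b}"
  have "card ?B = card (?f ` ?B)"
    by (intro card_image[symmetric]) (auto simp: inj_on_def)
  also have "\<dots> \<le> card (type_invariant ` tricentral_family (3 * m + 3))"
  proof (rule card_mono)
    show "?f ` ?B \<subseteq> type_invariant ` tricentral_family (3 * m + 3)"
    proof
      fix p assume "p \<in> ?f ` ?B"
      then obtain x q where p: "p = (3 * (x + q), 3 * q)"
        and xq: "x \<le> m - 2 * b" "1 \<le> q" "q \<le> b" by auto
      then have "x + 2 * q \<le> m" using assms by linarith
      with xq(2) show "p \<in> type_invariant ` tricentral_family (3 * m + 3)"
        unfolding p by (rule invariant_pair_realised)
    qed
  qed (simp add: finite_tricentral_family)
  also have "\<dots> \<le> N3 (3 * m + 3)"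
    by (rule card_type_invariants_le_N3)
  finally show ?thesis by (simp add: card_cartesian_product)
qed

lemma N3_ge_quadratic:
  assumes "15 \<le> n" "n mod 3 = 0"
  shows "(real n - 15)\<^sup>2 / 72 \<le> real (N3 n)"
proof -
  define m where "m = n div 3 - 1"
  have n: "n = 3 * m + 3" and m: "4 \<le> m" using assms unfolding m_def by presburger+
  \<comment> \<open>The product \<open>(m - 2 * b) * b\<close> is largest near
    \<open>b = m / 4\<close>, with value about \<open>m^2 / 8\<close>, which is the source of the
    constant 72 = 8 * 9.\<close>
  define b r where "b = m div 4" and "r = m mod 4"
  have mbr: "m = 4 * b + r" and r: "r < 4" and b: "1 \<le> b"
    using m by (auto simp: b_def r_def)
  have "(2 * b + r + 1) * b \<le> N3 n"
    using N3_ge_box[of b m] by (simp add: mbr n)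
  then have "real ((2 * b + r + 1) * b) \<le> real (N3 n)" by (rule of_nat_mono)
  then have "2 * (real b)\<^sup>2 + real b * (real r - 4) + 5 * real b \<le> real (N3 n)"
    by (simp add: power2_eq_square algebra_simps)
  \<comment> \<open>Here \<open>n - 15 = 3 * (m - 4)\<close> and
    \<open>m - 4 = 4 * b + (r - 4)\<close>. The comparison reduces to
    \<open>(r - 4)^2 / 8 \<le> 5 * b\<close>, whose left side is at most 2.\<close>
  moreover have "(real n - 15)\<^sup>2 / 72 = 2 * (real b)\<^sup>2 + real b * (real r - 4) + (real r - 4)\<^sup>2 / 8"
    by (simp add: n mbr power2_eq_square field_simps)
  moreover have "(real r - 4)\<^sup>2 \<le> 16"
    using r power2_le_iff_abs_le[of 4 "real r - 4"] by auto
  moreover have "1 \<le> real b"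
    using b by simp
  ultimately show ?thesis
    by linarith
qed

theorem theorem5p5:
  "(\<exists>c::real. c > 0 \<and>
      (\<exists>n0. \<forall>n::nat. n \<ge> n0 \<and> n mod 3 = 0 \<longrightarrow> real (N3 n) \<ge> c * (real n)\<^sup>2)) \<and>
   (\<forall>n::nat. n \<ge> 24 \<and> n mod 3 = 0 \<longrightarrow> int (N3 n) \<ge> \<lfloor>(real n - 15)\<^sup>2 / 72\<rfloor>)"
\<comment> \<open>For \<open>n \<ge> 30\<close> one has \<open>n - 15 \<ge> n / 2\<close>, and 288 =
  4 * 72.\<close>
proof (intro conjI exI[of _ "1 / 288 :: real"] exI[of _ 30] allI impI)
  fix n :: nat assume n: "n \<ge> 30 \<and> n mod 3 = 0"
  have "(real n / 2)\<^sup>2 \<le> (real n - 15)\<^sup>2"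
    using n by (intro power_mono) auto
  then have "1 / 288 * (real n)\<^sup>2 \<le> (real n - 15)\<^sup>2 / 72"
    by (simp add: power_divide)
  also have "\<dots> \<le> real (N3 n)"
    using n by (intro N3_ge_quadratic) auto
  finally show "1 / 288 * (real n)\<^sup>2 \<le> real (N3 n)" .
next
  fix n :: nat assume "n \<ge> 24 \<and> n mod 3 = 0"
  then have "(real n - 15)\<^sup>2 / 72 \<le> real (N3 n)"
    by (intro N3_ge_quadratic) auto
  then show "\<lfloor>(real n - 15)\<^sup>2 / 72\<rfloor> \<le> int (N3 n)"
    by linarith
qed simp

end
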